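(* Let $\Omega$ be a finite set and let $G\le\mathrm{Sym}(\Omega)$ be a nilpotent permutation group. Then $G$ is $2$-closed if and only if every Sylow subgroup of $G$ is $2$-closed.
   Context: For a finite set $\Omega$ and a permutation group $H\le\mathrm{Sym}(\Omega)$, $\mathrm{Orb}_2(H)$ denotes the set of orbits of the induced (componentwise) action of $H$ on $\Omega\times\Omega$. The $2$-closure $\overline{H}$ of $H$ is the largest subgroup of $\mathrm{Sym}(\Omega)$ such that $\mathrm{Orb}_2(\overline{H})=\mathrm{Orb}_2(H)$. The group $H$ is $2$-closed if $H=\overline{H}$. The Sylow subgroups of $G$ are regarded as subgroups of $\mathrm{Sym}(\Omega)$. *)

theory Defs
  imports
    "HOL-Algebra.Group_Action"
    "HOL-Algebra.Generated_Groups"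
    "HOL-Computational_Algebra.Primes"
begin

text \<open>
  \<open>Sym(\<Omega>)\<close> is the library group \<^const>\<open>BijGroup\<close> \<open>\<Omega>\<close>. A permutation group on \<open>\<Omega>\<close> is a set
  \<open>H\<close> with \<open>subgroup H (BijGroup \<Omega>)\<close>.
\<close>

abbreviation perm_group :: "'a set \<Rightarrow> ('a \<Rightarrow> 'a) set \<Rightarrow> ('a \<Rightarrow> 'a) monoid"
  where "perm_group \<Omega> H \<equiv> (BijGroup \<Omega>)\<lparr>carrier := H\<rparr>"

text \<open>
  The action is restricted to \<open>\<Omega> \<times> \<Omega>\<close> because the elements of \<open>BijGroup (\<Omega> \<times> \<Omega>)\<close>
  are extensional functions.
\<close>

definition pair_action :: "'a set \<Rightarrow> ('a \<Rightarrow> 'a) \<Rightarrow> 'a \<times> 'a \<Rightarrow> 'a \<times> 'a"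
  where "pair_action \<Omega> g = restrict (map_prod g g) (\<Omega> \<times> \<Omega>)"

definition orb2 :: "'a set \<Rightarrow> ('a \<Rightarrow> 'a) set \<Rightarrow> ('a \<times> 'a) set set"
  where "orb2 \<Omega> H = orbits (perm_group \<Omega> H) (\<Omega> \<times> \<Omega>) (pair_action \<Omega>)"

text \<open>\<open>GREATEST\<close> refers to inclusion. Existence is lemma \<open>two_closure_greatest\<close> below.\<close>

definition two_closure :: "'a set \<Rightarrow> ('a \<Rightarrow> 'a) set \<Rightarrow> ('a \<Rightarrow> 'a) set"
  where "two_closure \<Omega> H = (GREATEST K. subgroup K (BijGroup \<Omega>) \<and> orb2 \<Omega> K = orb2 \<Omega> H)"

definition two_closed :: "'a set \<Rightarrow> ('a \<Rightarrow> 'a) set \<Rightarrow> bool"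
  where "two_closed \<Omega> H \<longleftrightarrow> H = two_closure \<Omega> H"

text \<open>Nilpotency: the lower central series \<open>\<gamma>\<^sub>0 = G\<close>, \<open>\<gamma>\<^sub>n\<^sub>+\<^sub>1 = [\<gamma>\<^sub>n, G]\<close> reaches the trivial group.\<close>

primrec lower_central :: "('a, 'b) monoid_scheme \<Rightarrow> nat \<Rightarrow> 'a set"
  where
    "lower_central G 0 = carrier G"
  | "lower_central G (Suc n) = generate G
       {x \<otimes>\<^bsub>G\<^esub> y \<otimes>\<^bsub>G\<^esub> inv\<^bsub>G\<^esub> x \<otimes>\<^bsub>G\<^esub> inv\<^bsub>G\<^esub> y | x y. x \<in> lower_central G n \<and> y \<in> carrier G}"

definition nilpotent_group :: "('a, 'b) monoid_scheme \<Rightarrow> bool"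
  where "nilpotent_group G \<longleftrightarrow> group G \<and> (\<exists>n. lower_central G n = {\<one>\<^bsub>G\<^esub>})"

text \<open>
  For finite \<open>G\<close>. Primes not dividing the order of \<open>G\<close> are admitted; the corresponding
  Sylow subgroup is then the trivial group.
\<close>

definition sylow_subgroup :: "('a, 'b) monoid_scheme \<Rightarrow> 'a set \<Rightarrow> bool"
  where "sylow_subgroup G P \<longleftrightarrow> subgroup P G \<and>
    (\<exists>p::nat. prime p \<and> card P = p ^ multiplicity p (order G))"


lemma pair_action_group_action:
  assumes H: "subgroup H (BijGroup \<Omega>)"
  shows "group_action (perm_group \<Omega> H) (\<Omega> \<times> \<Omega>) (pair_action \<Omega>)"
proof -
  have sub: "H \<subseteq> Bij \<Omega>"
    using subgroup.subset[OF H] by (simp add: BijGroup_def)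
  have bij: "pair_action \<Omega> g \<in> Bij (\<Omega> \<times> \<Omega>)" if "g \<in> Bij \<Omega>" for g
  proof -
    have "bij_betw (map_prod g g) (\<Omega> \<times> \<Omega>) (\<Omega> \<times> \<Omega>)"
      using that by (auto simp: Bij_def intro: bij_betw_map_prod)
    then show ?thesis
      by (simp add: Bij_def pair_action_def)
  qed
  have mult: "pair_action \<Omega> (compose \<Omega> g h) = compose (\<Omega> \<times> \<Omega>) (pair_action \<Omega> g) (pair_action \<Omega> h)"
    if "g \<in> Bij \<Omega>" "h \<in> Bij \<Omega>" for g h
    using Bij_imp_funcset[OF that(2)]
    by (auto simp: fun_eq_iff pair_action_def compose_def restrict_def Pi_iff)
  have "pair_action \<Omega> \<in> hom (perm_group \<Omega> H) (BijGroup (\<Omega> \<times> \<Omega>))"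
    using sub bij mult by (auto simp: hom_def BijGroup_def subset_iff)
  then show ?thesis
    using subgroup.subgroup_is_group[OF H group_BijGroup] group_BijGroup
    by (simp add: group_action_def group_hom_def group_hom_axioms_def)
qed

lemma two_closure_exists:
  assumes H: "subgroup H (BijGroup \<Omega>)"
  obtains K where "subgroup K (BijGroup \<Omega>)" "orb2 \<Omega> K = orb2 \<Omega> H"
    "\<And>L. subgroup L (BijGroup \<Omega>) \<Longrightarrow> orb2 \<Omega> L = orb2 \<Omega> H \<Longrightarrow> L \<subseteq> K"
proof -
  let ?B = "BijGroup \<Omega>"
  define K where "K = {g \<in> carrier ?B. \<forall>O' \<in> orb2 \<Omega> H. pair_action \<Omega> g ` O' = O'}"
  have act: "group_action (perm_group \<Omega> L) (\<Omega> \<times> \<Omega>) (pair_action \<Omega>)" if "subgroup L ?B" for L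
    by (rule pair_action_group_action[OF that])
  have full: "group_action ?B (\<Omega> \<times> \<Omega>) (pair_action \<Omega>)"
    using act[OF group.subgroup_self[OF group_BijGroup]] by simp
  interpret F: group_action ?B "\<Omega> \<times> \<Omega>" "pair_action \<Omega>" by (rule full)
  interpret B: group ?B by (rule group_BijGroup)
  have orbsub: "O' \<subseteq> \<Omega> \<times> \<Omega>" if "subgroup L ?B" "O' \<in> orb2 \<Omega> L" for L O'
  proof -
    interpret A: group_action "perm_group \<Omega> L" "\<Omega> \<times> \<Omega>" "pair_action \<Omega>" by (rule act[OF that(1)])
    from that(2) obtain x where "x \<in> \<Omega> \<times> \<Omega>" "O' = orbit (perm_group \<Omega> L) (pair_action \<Omega>) x"
      by (auto simp: orb2_def orbits_def)
    then show ?thesis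
      using A.element_image unfolding orbit_def by blast
  qed
  have cm: "pair_action \<Omega> (g \<otimes>\<^bsub>?B\<^esub> h) x = pair_action \<Omega> g (pair_action \<Omega> h x)"
    if "g \<in> carrier ?B" "h \<in> carrier ?B" "x \<in> \<Omega> \<times> \<Omega>" for g h x
    using F.composition_rule that by metis
  have one: "pair_action \<Omega> \<one>\<^bsub>?B\<^esub> x = x" if "x \<in> \<Omega> \<times> \<Omega>" for x
    using F.id_eq_one that by (metis restrict_apply')
  have subK: "L \<subseteq> K" if L: "subgroup L ?B" and eq: "orb2 \<Omega> L = orb2 \<Omega> H" for L
  proof
    fix g assume g: "g \<in> L"
    have carr: "\<And>a. a \<in> L \<Longrightarrow> a \<in> carrier ?B" using subgroup.subset[OF L] by blast
    have "pair_action \<Omega> g ` O' = O'" if O: "O' \<in> orb2 \<Omega> H" for O'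
    proof -
      from O have "O' \<in> orb2 \<Omega> L" by (simp only: eq)
      then obtain x where x: "x \<in> \<Omega> \<times> \<Omega>" "O' = {pair_action \<Omega> a x | a. a \<in> L}"
        unfolding orb2_def orbits_def orbit_def by force
      have mem: "y \<in> O' \<longleftrightarrow> (\<exists>a\<in>L. y = pair_action \<Omega> a x)" for y
        unfolding x(2) by auto
      have "pair_action \<Omega> g (pair_action \<Omega> a x) \<in> O'" if "a \<in> L" for a
        using cm[OF carr[OF g] carr[OF that] x(1)] subgroup.m_closed[OF L g that] mem by metis
      moreover have "pair_action \<Omega> a x \<in> pair_action \<Omega> g ` O'" if a: "a \<in> L" for a
      proof -
        let ?h = "inv\<^bsub>?B\<^esub> g \<otimes>\<^bsub>?B\<^esub> a"
        have h: "?h \<in> L" using L g a by (simp add: subgroup.m_closed subgroup.m_inv_closed)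
        have "g \<otimes>\<^bsub>?B\<^esub> ?h = a"
          using carr[OF g] carr[OF a] by (simp add: B.m_assoc[symmetric])
        then have "pair_action \<Omega> a x = pair_action \<Omega> g (pair_action \<Omega> ?h x)"
          using cm[OF carr[OF g] carr[OF h] x(1)] by simp
        then show ?thesis using h mem by blast
      qed
      ultimately show ?thesis by (auto simp: mem)
    qed
    then show "g \<in> K" using carr[OF g] by (simp add: K_def)
  qed
  have K: "subgroup K ?B"
  proof (rule B.subgroupI)
    show "K \<subseteq> carrier ?B" by (auto simp: K_def)
    show "K \<noteq> {}" using subK[OF H refl] subgroup.one_closed[OF H] by blast
  next
    fix a b assume a: "a \<in> K" and b: "b \<in> K"
    have "pair_action \<Omega> (a \<otimes>\<^bsub>?B\<^esub> b) ` O' = O'" if O: "O' \<in> orb2 \<Omega> H" for O'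
    proof -
      have "pair_action \<Omega> (a \<otimes>\<^bsub>?B\<^esub> b) ` O' = pair_action \<Omega> a ` pair_action \<Omega> b ` O'"
        unfolding image_image using orbsub[OF H O] a b
        by (intro image_cong) (auto simp: K_def cm subset_iff)
      then show ?thesis using a b O by (simp add: K_def)
    qed
    then show "a \<otimes>\<^bsub>?B\<^esub> b \<in> K" using a b by (simp add: K_def)
  next
    fix a assume a: "a \<in> K"
    have ac: "a \<in> carrier ?B" using a by (simp add: K_def)
    have "pair_action \<Omega> (inv\<^bsub>?B\<^esub> a) ` O' = O'" if O: "O' \<in> orb2 \<Omega> H" for O'
    proof -
      have "pair_action \<Omega> (inv\<^bsub>?B\<^esub> a) ` pair_action \<Omega> a ` O' = id ` O'"
        unfolding image_image
      proof (intro image_cong refl)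
        fix x assume "x \<in> O'"
        then have x: "x \<in> \<Omega> \<times> \<Omega>" using orbsub[OF H O] by blast
        show "pair_action \<Omega> (inv\<^bsub>?B\<^esub> a) (pair_action \<Omega> a x) = id x"
          using cm[OF B.inv_closed[OF ac] ac x] one[OF x] ac by simp
      qed
      then show ?thesis using a O by (simp add: K_def)
    qed
    then show "inv\<^bsub>?B\<^esub> a \<in> K" using ac by (simp add: K_def)
  qed
  have same: "orbit (perm_group \<Omega> K) (pair_action \<Omega>) x = orbit (perm_group \<Omega> H) (pair_action \<Omega>) x"
    if x: "x \<in> \<Omega> \<times> \<Omega>" for x
  proof
    interpret A: group_action "perm_group \<Omega> H" "\<Omega> \<times> \<Omega>" "pair_action \<Omega>" by (rule act[OF H])
    let ?O = "orbit (perm_group \<Omega> H) (pair_action \<Omega>) x"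
    have O: "?O \<in> orb2 \<Omega> H" using x by (auto simp: orb2_def orbits_def)
    have "pair_action \<Omega> k x \<in> ?O" if "k \<in> K" for k
      using that O A.orbit_refl[OF x] by (auto simp: K_def)
    then show "orbit (perm_group \<Omega> K) (pair_action \<Omega>) x \<subseteq> ?O"
      by (auto simp: orbit_def[of "perm_group \<Omega> K"])
    show "?O \<subseteq> orbit (perm_group \<Omega> K) (pair_action \<Omega>) x"
      using subK[OF H refl] by (auto simp: orbit_def)
  qed
  have "orb2 \<Omega> K = orb2 \<Omega> H"
    unfolding orb2_def orbits_def using same by blast
  then show thesis using that K subK by blast
qed

lemma two_closure_greatest:
  assumes "subgroup H (BijGroup \<Omega>)"
  shows "subgroup (two_closure \<Omega> H) (BijGroup \<Omega>)"
    and "orb2 \<Omega> (two_closure \<Omega> H) = orb2 \<Omega> H"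
    and "\<And>L. subgroup L (BijGroup \<Omega>) \<Longrightarrow> orb2 \<Omega> L = orb2 \<Omega> H \<Longrightarrow> L \<subseteq> two_closure \<Omega> H"
proof -
  obtain K where K: "subgroup K (BijGroup \<Omega>)" "orb2 \<Omega> K = orb2 \<Omega> H"
    "\<And>L. subgroup L (BijGroup \<Omega>) \<Longrightarrow> orb2 \<Omega> L = orb2 \<Omega> H \<Longrightarrow> L \<subseteq> K"
    using two_closure_exists[OF assms] by metis
  have "two_closure \<Omega> H = K"
    unfolding two_closure_def by (rule Greatest_equality) (use K in auto)
  then show "subgroup (two_closure \<Omega> H) (BijGroup \<Omega>)"
    and "orb2 \<Omega> (two_closure \<Omega> H) = orb2 \<Omega> H"
    and "\<And>L. subgroup L (BijGroup \<Omega>) \<Longrightarrow> orb2 \<Omega> L = orb2 \<Omega> H \<Longrightarrow> L \<subseteq> two_closure \<Omega> H"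
    using K by auto
qed

end

theory Submission
  imports Defs "HOL-Algebra.Sylow" "HOL-Algebra.Zassenhaus" "HOL-Algebra.Multiplicative_Group"
    "HOL-Number_Theory.Cong"
begin

text \<open>
  Let \<open>A\<close> and \<open>B\<close> be commuting permutation groups whose exponents are coprime. If \<open>x\<close> lies in the
  2-closure of \<open>AB\<close> and \<open>x a = u v a\<close> with \<open>u \<in> A\<close>, \<open>v \<in> B\<close>, then \<open>u a\<close> depends on \<open>x\<close> and \<open>a\<close> only:
  two choices differ by elements \<open>w \<in> A\<close>, \<open>c \<in> B\<close> with \<open>w a = c a\<close>, hence \<open>w\<^sup>k a = c\<^sup>k a\<close> for all \<open>k\<close>,
  and coprimality gives \<open>w a = a\<close>. Thus \<open>a \<mapsto> u a\<close> is a permutation in the 2-closure of \<open>A\<close>, and \<open>x\<close> is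
  the product of it and its counterpart for \<open>B\<close>. Adding one Sylow subgroup at a time shows that \<open>G\<close>
  is 2-closed when its Sylow subgroups are. Conversely, if \<open>G\<close> is 2-closed and \<open>x\<close> lies in the
  2-closure of the Sylow \<open>p\<close>-subgroup \<open>P\<close>, the \<open>p'\<close>-part of \<open>x\<close> centralises \<open>P\<close> and agrees with
  an element of \<open>P\<close> at every point, so it is trivial by the same computation.
\<close>

section \<open>Commutators of elements of coprime order in a nilpotent group\<close>

lemma (in group) pow_coprime_eq_one:
  assumes "c \<in> carrier G" "c [^] (m::nat) = \<one>" "c [^] (n::nat) = \<one>" "coprime m n"
  shows "c = \<one>"
  using assms by (metis coprime_common_divisor_nat ord_eq_1 pow_eq_id)

text \<open>Here \<open>c\<close> is the commutator of \<open>x\<close> and \<open>y\<close>, given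
  by an equation free of inverses. Each factor \<open>x\<close> that moves past \<open>y\<close>
  leaves one \<open>c\<close> behind, and these collect on the left because \<open>c\<close>
  commutes with \<open>x\<close>.\<close>

lemma (in group) pow_mult_commutator:
  assumes [simp]: "x \<in> carrier G" "y \<in> carrier G" "c \<in> carrier G"
    and xy: "x \<otimes> y = c \<otimes> (y \<otimes> x)" and cx: "c \<otimes> x = x \<otimes> c"
  shows "x [^] (k::nat) \<otimes> y = c [^] k \<otimes> (y \<otimes> x [^] k)"
proof (induction k)
  case (Suc k)
  have pc: "x [^] k \<otimes> c = c \<otimes> x [^] k"
    using group_commutes_pow[OF cx[symmetric]] by simp
  have "x [^] Suc k \<otimes> y = x [^] k \<otimes> (c \<otimes> (y \<otimes> x))"
    by (simp add: m_assoc xy)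
  also have "\<dots> = c \<otimes> (x [^] k \<otimes> y) \<otimes> x"
    by (simp add: pc flip: m_assoc)
  also have "\<dots> = c [^] Suc k \<otimes> (y \<otimes> x [^] Suc k)"
    unfolding Suc nat_pow_Suc2[OF assms(3)] by (simp add: m_assoc)
  finally show ?case .
qed simp

lemma (in group) pow_commutator_eq_one:
  assumes [simp]: "x \<in> carrier G" "y \<in> carrier G" "c \<in> carrier G"
    and xy: "x \<otimes> y = c \<otimes> (y \<otimes> x)" and cx: "c \<otimes> x = x \<otimes> c" and x: "x [^] (k::nat) = \<one>"
  shows "c [^] k = \<one>"
  using pow_mult_commutator[OF assms(1-5), of k] x by simp

text \<open>The order of the commutator divides \<open>m\<close> because of \<open>x\<close>.
  Exchanging \<open>x\<close> and \<open>y\<close> replaces \<open>c\<close> by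
  \<open>inv c\<close>, so the order divides \<open>n\<close> as well.\<close>

lemma (in group) coprime_commutator_eq_one:
  assumes [simp]: "x \<in> carrier G" "y \<in> carrier G" "c \<in> carrier G"
    and xy: "x \<otimes> y = c \<otimes> (y \<otimes> x)" and cx: "c \<otimes> x = x \<otimes> c" and cy: "c \<otimes> y = y \<otimes> c"
    and "x [^] (m::nat) = \<one>" "y [^] (n::nat) = \<one>" "coprime m n"
  shows "c = \<one>"
proof (rule pow_coprime_eq_one)
  show "c [^] m = \<one>" by (rule pow_commutator_eq_one[of x y]) (use assms in auto)
  have "y \<otimes> x = inv c \<otimes> (x \<otimes> y)"
    by (simp add: xy flip: m_assoc)
  moreover have "inv c \<otimes> y = y \<otimes> inv c"
  proof -
    have "inv c \<otimes> y = inv c \<otimes> (y \<otimes> c) \<otimes> inv c" by (simp add: m_assoc)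
    also have "\<dots> = inv c \<otimes> (c \<otimes> y) \<otimes> inv c" by (simp add: cy)
    also have "\<dots> = y \<otimes> inv c" by (simp flip: m_assoc)
    finally show ?thesis .
  qed
  ultimately have "inv c [^] n = \<one>"
    by (rule pow_commutator_eq_one[OF assms(2,1) inv_closed[OF assms(3)] _ _ assms(8)])
  then show "c [^] n = \<one>" by (simp add: nat_pow_inv)
qed (use assms in auto)

text \<open>Conjugation by \<open>g\<close> sends the commutator of \<open>x\<close> and
  \<open>y\<close> to the commutator of their conjugates, and by induction the conjugate of
  \<open>x\<close> stays in the preceding term. Normality permits passing to the quotient by a term
  of the series.\<close>

lemma (in group) lower_central_normal: "lower_central G n \<lhd> G"
proof (induction n)
  case 0
  show ?case by (simp add: normal_inv_iff subgroup_self)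
next
  case (Suc n)
  let ?L = "lower_central G n"
  have sub: "x \<in> carrier G" if "x \<in> ?L" for x
    using that normal_imp_subgroup[OF Suc] subgroup.mem_carrier by metis
  show ?case unfolding lower_central.simps
  proof (rule normal_generateI)
    fix h g assume h: "h \<in> {x \<otimes> y \<otimes> inv x \<otimes> inv y |x y. x \<in> ?L \<and> y \<in> carrier G}"
      and [simp]: "g \<in> carrier G"
    from h obtain x y where h: "h = x \<otimes> y \<otimes> inv x \<otimes> inv y" "x \<in> ?L" and [simp]: "y \<in> carrier G"
      by auto
    have [simp]: "x \<in> carrier G" using h sub by auto
    \<comment> \<open>After \<open>m_assoc\<close> has moved all brackets to the right,
      \<open>inv g\<close> and \<open>g\<close> meet only inside longer products; this rule cancels
      them there.\<close>
    have 1: "a \<otimes> (inv g \<otimes> (g \<otimes> b)) = a \<otimes> b" if "a \<in> carrier G" "b \<in> carrier G" for a b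
      using that by (simp flip: m_assoc[of "inv g"])
    have "g \<otimes> h \<otimes> inv g = (g \<otimes> x \<otimes> inv g) \<otimes> (g \<otimes> y \<otimes> inv g) \<otimes> inv (g \<otimes> x \<otimes> inv g) \<otimes> inv (g \<otimes> y \<otimes> inv g)"
      by (simp add: h inv_mult_group m_assoc 1)
    moreover have "g \<otimes> x \<otimes> inv g \<in> ?L" using h Suc by (simp add: normal_inv_iff)
    ultimately show "g \<otimes> h \<otimes> inv g \<in> {x \<otimes> y \<otimes> inv x \<otimes> inv y |x y. x \<in> ?L \<and> y \<in> carrier G}"
      by (blast intro: m_closed inv_closed \<open>g \<in> carrier G\<close> \<open>y \<in> carrier G\<close>)
  qed (use sub in auto)
qed

lemma (in normal) rcos_eq_self_iff:
  assumes "x \<in> carrier G" shows "H #> x = H \<longleftrightarrow> x \<in> H"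
  using assms by (metis coset_join1 coset_join2 is_group subgroup_axioms subset)

text \<open>The commutator descends through the lower central series: modulo the next term it is
  central, and its order divides both \<open>m\<close> and \<open>n\<close>.\<close>
lemma coprime_pow_commute:
  assumes "nilpotent_group G" and x[simp]: "x \<in> carrier G" and y[simp]: "y \<in> carrier G"
    and pow: "x [^]\<^bsub>G\<^esub> (m::nat) = \<one>\<^bsub>G\<^esub>" "y [^]\<^bsub>G\<^esub> (n::nat) = \<one>\<^bsub>G\<^esub>" and mn: "coprime m n"
  shows "x \<otimes>\<^bsub>G\<^esub> y = y \<otimes>\<^bsub>G\<^esub> x"
proof -
  interpret group G using assms by (simp add: nilpotent_group_def)
  have commutator: "a \<otimes>\<^bsub>G\<^esub> b \<otimes>\<^bsub>G\<^esub> inv\<^bsub>G\<^esub> a \<otimes>\<^bsub>G\<^esub> inv\<^bsub>G\<^esub> b = a \<otimes>\<^bsub>G\<^esub> b \<otimes>\<^bsub>G\<^esub> inv\<^bsub>G\<^esub> (b \<otimes>\<^bsub>G\<^esub> a)"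
    if "a \<in> carrier G" "b \<in> carrier G" for a b
    using that by (simp add: inv_mult_group m_assoc)
  define c where "c = x \<otimes>\<^bsub>G\<^esub> y \<otimes>\<^bsub>G\<^esub> inv\<^bsub>G\<^esub> x \<otimes>\<^bsub>G\<^esub> inv\<^bsub>G\<^esub> y"
  have [simp]: "c \<in> carrier G" by (simp add: c_def)
  have xy: "x \<otimes>\<^bsub>G\<^esub> y = c \<otimes>\<^bsub>G\<^esub> (y \<otimes>\<^bsub>G\<^esub> x)"
    unfolding c_def by (subst commutator) (simp_all add: m_assoc)
  have "c \<in> lower_central G i" for i
  proof (induction i)
    case (Suc i)
    define N where "N = lower_central G (Suc i)"
    interpret N: normal N G unfolding N_def by (rule lower_central_normal)
    interpret Q: group "G Mod N" by (rule N.factorgroup_is_group)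
    have mult: "(N #>\<^bsub>G\<^esub> a) \<otimes>\<^bsub>G Mod N\<^esub> (N #>\<^bsub>G\<^esub> b) = N #>\<^bsub>G\<^esub> (a \<otimes>\<^bsub>G\<^esub> b)"
      if "a \<in> carrier G" "b \<in> carrier G" for a b
      using that by (simp add: N.rcos_sum)
    have car: "N #>\<^bsub>G\<^esub> a \<in> carrier (G Mod N)" if "a \<in> carrier G" for a
      using that by (auto simp: carrier_FactGroup)
    \<comment> \<open>By the induction hypothesis \<open>c\<close> lies in the term before
      \<open>N\<close>, so its commutator with any \<open>g\<close> is one of the generators of
      \<open>N\<close>.\<close>
    have central: "N #>\<^bsub>G\<^esub> (c \<otimes>\<^bsub>G\<^esub> g) = N #>\<^bsub>G\<^esub> (g \<otimes>\<^bsub>G\<^esub> c)" if [simp]: "g \<in> carrier G" for g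
    proof -
      let ?d = "c \<otimes>\<^bsub>G\<^esub> g \<otimes>\<^bsub>G\<^esub> inv\<^bsub>G\<^esub> c \<otimes>\<^bsub>G\<^esub> inv\<^bsub>G\<^esub> g"
      have "?d \<in> N" using Suc that unfolding N_def lower_central.simps by (blast intro: generate.incl)
      then have "N #>\<^bsub>G\<^esub> ?d = N" using N.rcos_eq_self_iff by simp
      then have "N #>\<^bsub>G\<^esub> (?d \<otimes>\<^bsub>G\<^esub> (g \<otimes>\<^bsub>G\<^esub> c)) = N #>\<^bsub>G\<^esub> (g \<otimes>\<^bsub>G\<^esub> c)"
        by (subst coset_mult_assoc[symmetric]) (simp_all add: N.subset)
      moreover have "?d \<otimes>\<^bsub>G\<^esub> (g \<otimes>\<^bsub>G\<^esub> c) = c \<otimes>\<^bsub>G\<^esub> g"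
        by (subst commutator) (simp_all add: m_assoc)
      ultimately show ?thesis by simp
    qed
    have "N #>\<^bsub>G\<^esub> c = \<one>\<^bsub>G Mod N\<^esub>"
    proof (rule Q.coprime_commutator_eq_one)
      show "(N #>\<^bsub>G\<^esub> x) [^]\<^bsub>G Mod N\<^esub> m = \<one>\<^bsub>G Mod N\<^esub>" "(N #>\<^bsub>G\<^esub> y) [^]\<^bsub>G Mod N\<^esub> n = \<one>\<^bsub>G Mod N\<^esub>"
        using pow N.subset by (simp_all add: N.FactGroup_pow coset_mult_one)
    qed (use mn in \<open>simp_all add: mult central car xy del: mult_FactGroup\<close>)
    then show ?case using N.rcos_eq_self_iff by (simp add: N_def)
  qed simp
  then have "c = \<one>\<^bsub>G\<^esub>"
    using assms(1) unfolding nilpotent_group_def by blast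
  then show ?thesis using xy by simp
qed

section \<open>Sylow subgroups of a finite nilpotent group\<close>

lemma (in group) sylow_exists:
  assumes "finite (carrier G)" "prime p"
  obtains P where "subgroup P G" "card P = p ^ multiplicity p (order G)"
proof -
  obtain m where "order G = p ^ multiplicity p (order G) * m"
    using multiplicity_dvd by (metis dvdE)
  then show ?thesis
    using sylow_thm[OF assms(2) is_group _ assms(1)] that by metis
qed

lemma (in group) subgroup_pow_card:
  assumes "subgroup H G" "finite H" "x \<in> H"
  shows "x [^] card H = \<one>"
  using group.pow_order_eq_1[OF subgroup_imp_group[OF assms(1)], of x] assms(2,3)
  by (simp add: order_def flip: nat_pow_consistent)

text \<open>The normalizer of \<open>P\<close> contains \<open>P\<close> itself and, for every other
  prime \<open>q\<close>, a Sylow \<open>q\<close>-subgroup, since elements of coprime order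
  commute. Hence every prime power dividing the order of \<open>G\<close> divides the order of the
  normalizer, which is therefore all of \<open>G\<close>.\<close>

lemma sylow_normal:
  assumes nil: "nilpotent_group G" and fin: "finite (carrier G)"
    and P: "subgroup P G" "prime p" "card P = p ^ multiplicity p (order G)"
  shows "P \<lhd> G"
proof -
  interpret group G using nil by (simp add: nilpotent_group_def)
  have finsub: "finite H" if "subgroup H G" for H
    using that fin finite_subset subgroup.subset by blast
  have Pc: "x \<in> carrier G" if "x \<in> P" for x using P(1) that subgroup.mem_carrier by metis
  let ?N = "normalizer G P"
  have N: "subgroup ?N G" by (rule normalizer_imp_subgroup) (use Pc in auto)
  have "multiplicity q (order G) \<le> multiplicity q (card ?N)" if q: "prime q" for q
  proof -
    obtain Q where Q: "subgroup Q G" "card Q = q ^ multiplicity q (order G)"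
      using sylow_exists[OF fin q] .
    have "\<exists>H. subgroup H G \<and> H \<subseteq> ?N \<and> card H = q ^ multiplicity q (order G)"
    proof (cases "q = p")
      case True
      have "P \<subseteq> ?N"
        using subgroup.subset[OF normal_imp_subgroup[OF subgroup_in_normalizer[OF P(1)]]] by simp
      then show ?thesis using True P by blast
    next
      case False
      have comm: "g \<otimes>\<^bsub>G\<^esub> x = x \<otimes>\<^bsub>G\<^esub> g" if "g \<in> Q" "x \<in> P" for g x
      proof (rule coprime_pow_commute[OF nil])
        show "g [^]\<^bsub>G\<^esub> card Q = \<one>\<^bsub>G\<^esub>" "x [^]\<^bsub>G\<^esub> card P = \<one>\<^bsub>G\<^esub>"
          using that subgroup_pow_card Q(1) P(1) finsub by auto
        show "coprime (card Q) (card P)"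
          using False q P(2) unfolding P(3) Q(2) by (simp add: primes_coprime)
      qed (use that Pc subgroup.mem_carrier[OF Q(1)] in auto)
      have "g \<in> ?N" if g: "g \<in> Q" for g
      proof -
        have [simp]: "g \<in> carrier G" using g Q(1) subgroup.mem_carrier by metis
        have "g \<otimes>\<^bsub>G\<^esub> x \<otimes>\<^bsub>G\<^esub> inv\<^bsub>G\<^esub> g = x" if "x \<in> P" for x
          using comm[OF g that] Pc[OF that] by (simp add: m_assoc)
        then have "g <#\<^bsub>G\<^esub> P #>\<^bsub>G\<^esub> inv\<^bsub>G\<^esub> g = P"
          by (auto simp: l_coset_def r_coset_def)
        then show ?thesis using Pc by (auto simp: normalizer_def stabilizer_def)
      qed
      then show ?thesis using Q by blast
    qed
    then obtain H where H: "subgroup H G" "H \<subseteq> ?N" "card H = q ^ multiplicity q (order G)"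
      by blast
    have "subgroup H (G\<lparr>carrier := ?N\<rparr>)"
      using H N by (simp add: subgroup_incl)
    then have "card (rcosets\<^bsub>G\<lparr>carrier := ?N\<rparr>\<^esub> H) * card H = card ?N"
      using group.lagrange[OF subgroup_imp_group[OF N], of H] by (simp add: order_def)
    then have "card H dvd card ?N" by (rule dvdI[OF trans[OF sym mult.commute]])
    \<comment> \<open>Zero has multiplicity 0 by convention, so divisibility bounds the multiplicity
      from below only for a nonzero number.\<close>
    moreover have "card ?N \<noteq> 0"
      using finsub[OF N] subgroup.one_closed[OF N] by auto
    ultimately show ?thesis
      using q H(3) by (intro multiplicity_geI) auto
  qed
  then have "order G dvd card ?N"
    using fin order_gt_0_iff_finite by (intro multiplicity_le_imp_dvd) auto
  then have "card (carrier G) \<le> card ?N"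
    using finsub[OF N] subgroup.one_closed[OF N]
    by (intro dvd_imp_le) (auto simp: order_def card_gt_0_iff)
  then have "?N = carrier G"
    using card_seteq[OF fin subgroup.subset[OF N]] by simp
  then show ?thesis
    using subgroup_in_normalizer[OF P(1)] by simp
qed

text \<open>By normality the quotient by \<open>P\<close> is a group, and its order is prime to
  \<open>p\<close>. An element killed by the order of \<open>P\<close> has an image whose order
  divides both numbers, so the image is trivial. Membership in a Sylow subgroup thereby becomes a
  condition on powers.\<close>

lemma sylow_eq_torsion:
  assumes nil: "nilpotent_group G" and fin: "finite (carrier G)"
    and P: "subgroup P G" "prime p" "card P = p ^ multiplicity p (order G)"
  shows "P = {x \<in> carrier G. x [^]\<^bsub>G\<^esub> p ^ multiplicity p (order G) = \<one>\<^bsub>G\<^esub>}"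
proof -
  interpret group G using nil by (simp add: nilpotent_group_def)
  interpret N: normal P G by (rule sylow_normal[OF assms])
  interpret Q: group "G Mod P" by (rule N.factorgroup_is_group)
  have "x \<in> P" if [simp]: "x \<in> carrier G" and x: "x [^]\<^bsub>G\<^esub> card P = \<one>\<^bsub>G\<^esub>" for x
  proof -
    have "order (G Mod P) * card P = order G"
      by (simp add: FactGroup_def lagrange N.subgroup_axioms order_def)
    then have ord: "order G = p ^ multiplicity p (order G) * order (G Mod P)"
      using P(3) by (simp add: mult.commute)
    have "\<not> p dvd order (G Mod P)"
    proof
      assume "p dvd order (G Mod P)"
      then have "p ^ Suc (multiplicity p (order G)) dvd order G"
        by (subst ord) (simp add: mult.commute mult_dvd_mono)
      then show False
        using P(2) fin order_gt_0_iff_finite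
        by (metis neq0_conv not_prime_unit power_dvd_iff_le_multiplicity not_less_eq_eq order_refl)
    qed
    then have cop: "coprime (card P) (order (G Mod P))"
      using P by (simp add: prime_imp_coprime coprime_commute)
    have "P #>\<^bsub>G\<^esub> x = \<one>\<^bsub>G Mod P\<^esub>"
    proof (rule Q.pow_coprime_eq_one[OF _ _ _ cop])
      show *: "P #>\<^bsub>G\<^esub> x \<in> carrier (G Mod P)" by (auto simp: carrier_FactGroup)
      show "(P #>\<^bsub>G\<^esub> x) [^]\<^bsub>G Mod P\<^esub> card P = \<one>\<^bsub>G Mod P\<^esub>"
        using x N.subset by (simp add: N.FactGroup_pow coset_mult_one)
      show "(P #>\<^bsub>G\<^esub> x) [^]\<^bsub>G Mod P\<^esub> order (G Mod P) = \<one>\<^bsub>G Mod P\<^esub>"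
        using * by (rule Q.pow_order_eq_1)
    qed
    then show ?thesis using N.rcos_eq_self_iff by simp
  qed
  then show ?thesis
    using subgroup_pow_card[OF P(1)] N.subset finite_subset[OF _ fin] P(3) by auto
qed

section \<open>Splitting an element into parts of coprime order\<close>

lemma (in group) pow_eq_pow_cong:
  assumes x: "x \<in> carrier G" "x [^] (m::nat) = \<one>" and "[i = j] (mod m)"
  shows "x [^] i = x [^] j"
proof -
  have "x [^] (k * m + l) = x [^] l" for k l :: nat
    using x by (simp flip: nat_pow_mult add: mult.commute[of k] nat_pow_pow[symmetric])
  moreover have "(\<exists>k. i = k * m + j) \<or> (\<exists>k. j = k * m + i)"
    using assms(3) by (metis cong_le_nat cong_sym nat_le_linear)
  ultimately show ?thesis by metis
qed

text \<open>The factors are the powers \<open>x [^] e\<close> and \<open>x [^] f\<close>, with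
  \<open>e\<close> equal to 1 modulo \<open>m\<close> and 0 modulo \<open>n\<close>, and
  \<open>f\<close> the other way round. Then \<open>e + f\<close> is 1 modulo \<open>m * n\<close>,
  while \<open>e * m\<close> and \<open>f * n\<close> are 0.\<close>

lemma (in group) pow_coprime_decomp:
  assumes x: "x \<in> carrier G" "x [^] (m * n :: nat) = \<one>" and mn: "coprime m n"
  obtains y z where "y \<in> carrier G" "z \<in> carrier G" "x = y \<otimes> z" "y [^] m = \<one>" "z [^] n = \<one>"
proof -
  obtain e where e: "[e = 1] (mod m)" "[e = 0] (mod n)"
    using binary_chinese_remainder_nat[OF mn] by metis
  obtain f where f: "[f = 0] (mod m)" "[f = 1] (mod n)"
    using binary_chinese_remainder_nat[OF mn] by metis
  have "[e + f = 1 + 0] (mod m)" "[e + f = 0 + 1] (mod n)"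
    using e f cong_add by blast+
  then have "[e + f = 1] (mod m * n)"
    using mn by (simp add: coprime_cong_mult_nat)
  then have "x [^] (e + f) = x [^] (1::nat)"
    using x pow_eq_pow_cong by blast
  then have 1: "x = x [^] e \<otimes> x [^] f"
    using x by (simp add: nat_pow_mult)
  have "[e * m = 0] (mod m * n)" "[f * n = 0] (mod m * n)"
    using e(2) f(1) by (simp_all add: cong_0_iff mult.commute mult_dvd_mono)
  then have "x [^] (e * m) = x [^] (0::nat)" "x [^] (f * n) = x [^] (0::nat)"
    using x pow_eq_pow_cong by blast+
  then have "(x [^] e) [^] m = \<one>" "(x [^] f) [^] n = \<one>"
    using x by (simp_all add: nat_pow_pow)
  with 1 show ?thesis using that x by blast
qed

section \<open>Pointwise computation in the symmetric group\<close>

lemma BijGroup_mult_apply [simp]: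
  "g \<in> Bij S \<Longrightarrow> h \<in> Bij S \<Longrightarrow> a \<in> S \<Longrightarrow> (g \<otimes>\<^bsub>BijGroup S\<^esub> h) a = g (h a)"
  by (simp add: BijGroup_def compose_def)

lemma BijGroup_one_apply [simp]: "a \<in> S \<Longrightarrow> \<one>\<^bsub>BijGroup S\<^esub> a = a"
  by (simp add: BijGroup_def)

lemma carrier_BijGroup [simp]: "carrier (BijGroup S) = Bij S"
  by (simp add: BijGroup_def)

lemma Bij_apply_closed [simp]: "g \<in> Bij S \<Longrightarrow> a \<in> S \<Longrightarrow> g a \<in> S"
  using Bij_imp_funcset by blast

lemma Bij_eqI: "g \<in> Bij S \<Longrightarrow> h \<in> Bij S \<Longrightarrow> (\<And>a. a \<in> S \<Longrightarrow> g a = h a) \<Longrightarrow> g = h"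
  by (meson Bij_imp_extensional extensionalityI)

lemma Bij_one_closed [simp]: "\<one>\<^bsub>BijGroup S\<^esub> \<in> Bij S"
  by (simp add: BijGroup_def id_Bij)

lemma Bij_mult_closed [simp]: "g \<in> Bij S \<Longrightarrow> h \<in> Bij S \<Longrightarrow> g \<otimes>\<^bsub>BijGroup S\<^esub> h \<in> Bij S"
  using monoid.m_closed[OF group.is_monoid[OF group_BijGroup]] by fastforce

lemma Bij_inv_closed [simp]: "g \<in> Bij S \<Longrightarrow> inv\<^bsub>BijGroup S\<^esub> g \<in> Bij S"
  using group.inv_closed[OF group_BijGroup] by fastforce

lemma BijGroup_inv_apply [simp]:
  assumes "g \<in> Bij S" "a \<in> S"
  shows "(inv\<^bsub>BijGroup S\<^esub> g) (g a) = a" "g ((inv\<^bsub>BijGroup S\<^esub> g) a) = a"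
  using assms group.l_inv[OF group_BijGroup, of g S] group.r_inv[OF group_BijGroup, of g S]
  by (metis BijGroup_mult_apply BijGroup_one_apply Bij_inv_closed carrier_BijGroup)+

lemma subgroup_BijGroup_mem: "subgroup H (BijGroup S) \<Longrightarrow> h \<in> H \<Longrightarrow> h \<in> Bij S"
  using subgroup.mem_carrier by fastforce

lemma finite_Bij: "finite S \<Longrightarrow> finite (Bij S)"
proof (rule finite_subset)
  show "Bij S \<subseteq> S \<rightarrow>\<^sub>E S"
    by (auto simp: Bij_def PiE_def bij_betw_imp_funcset)
qed (rule finite_PiE)

section \<open>The 2-closure described by pairs of points\<close>

lemma orb2_eq_image: "orb2 \<Omega> H = (\<lambda>(a, b). {(h a, h b) |h. h \<in> H}) ` (\<Omega> \<times> \<Omega>)"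
  unfolding orb2_def orbits_def Setcompr_eq_image
  by (rule image_cong) (auto simp: orbit_def pair_action_def)

text \<open>The permutations that agree with some element of \<open>H\<close> on each pair of points
  form a subgroup with the same orbits on pairs as \<open>H\<close>, so the 2-closure contains them.
  Conversely, an element of the 2-closure keeps every pair in its \<open>H\<close>-orbit. All later
  arguments use this criterion in place of \<open>GREATEST\<close>.\<close>

lemma mem_two_closure_iff:
  assumes H: "subgroup H (BijGroup \<Omega>)"
  shows "x \<in> two_closure \<Omega> H \<longleftrightarrow>
    x \<in> Bij \<Omega> \<and> (\<forall>a\<in>\<Omega>. \<forall>b\<in>\<Omega>. \<exists>h\<in>H. x a = h a \<and> x b = h b)"
proof -
  define K where "K = {x \<in> Bij \<Omega>. \<forall>a\<in>\<Omega>. \<forall>b\<in>\<Omega>. \<exists>h\<in>H. x a = h a \<and> x b = h b}"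
  note HB[simp] = subgroup_BijGroup_mem[OF H]
  interpret B: group "BijGroup \<Omega>" by (rule group_BijGroup)
  have HK: "H \<subseteq> K" by (auto simp: K_def)
  have KD: "\<exists>h\<in>H. x a = h a \<and> x b = h b" if "x \<in> K" "a \<in> \<Omega>" "b \<in> \<Omega>" for x a b
    using that by (simp add: K_def)
  have "subgroup K (BijGroup \<Omega>)"
  proof (rule B.subgroupI)
    show "K \<noteq> {}" using HK subgroup.one_closed[OF H] by blast
  next
    fix x assume x: "x \<in> K"
    then have [simp]: "x \<in> Bij \<Omega>" by (simp add: K_def)
    have "\<exists>h\<in>H. (inv\<^bsub>BijGroup \<Omega>\<^esub> x) a = h a \<and> (inv\<^bsub>BijGroup \<Omega>\<^esub> x) b = h b"
      if ab[simp]: "a \<in> \<Omega>" "b \<in> \<Omega>" for a b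
    proof -
      let ?i = "inv\<^bsub>BijGroup \<Omega>\<^esub> x"
      \<comment> \<open>The condition on \<open>x\<close> is applied at the preimages of
        \<open>a\<close> and \<open>b\<close>; the inverse of the resulting \<open>h\<close> then
        agrees with that of \<open>x\<close> at \<open>a\<close> and \<open>b\<close>.\<close>
      obtain h where h: "h \<in> H" "x (?i a) = h (?i a)" "x (?i b) = h (?i b)"
        using KD[OF x Bij_apply_closed Bij_apply_closed, of ?i a ?i b] ab Bij_inv_closed[OF \<open>x \<in> Bij \<Omega>\<close>]
        by blast
      then have "(inv\<^bsub>BijGroup \<Omega>\<^esub> h) a = ?i a" "(inv\<^bsub>BijGroup \<Omega>\<^esub> h) b = ?i b"
        by (metis BijGroup_inv_apply Bij_apply_closed Bij_inv_closed HB \<open>x \<in> Bij \<Omega>\<close> ab)+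
      then show ?thesis
        using h(1) subgroup.m_inv_closed[OF H] by metis
    qed
    then show "inv\<^bsub>BijGroup \<Omega>\<^esub> x \<in> K" by (simp add: K_def)
  next
    fix x y assume xy: "x \<in> K" "y \<in> K"
    then have [simp]: "x \<in> Bij \<Omega>" "y \<in> Bij \<Omega>" by (simp_all add: K_def)
    have "\<exists>h\<in>H. (x \<otimes>\<^bsub>BijGroup \<Omega>\<^esub> y) a = h a \<and> (x \<otimes>\<^bsub>BijGroup \<Omega>\<^esub> y) b = h b"
      if ab[simp]: "a \<in> \<Omega>" "b \<in> \<Omega>" for a b
    proof -
      obtain h where h: "h \<in> H" "y a = h a" "y b = h b"
        using KD[OF xy(2), of a b] ab by blast
      \<comment> \<open>The element \<open>k\<close> is chosen for the points to which
        \<open>y\<close> sends \<open>a\<close> and \<open>b\<close>, so that \<open>k\<close> after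
        \<open>h\<close> serves for the product.\<close>
      moreover obtain k where k: "k \<in> H" "x (h a) = k (h a)" "x (h b) = k (h b)"
        using KD[OF xy(1), of "h a" "h b"] h(1) by auto
      ultimately show ?thesis
        using subgroup.m_closed[OF H k(1) h(1)] by (intro bexI[of _ "k \<otimes>\<^bsub>BijGroup \<Omega>\<^esub> h"]) simp_all
    qed
    then show "x \<otimes>\<^bsub>BijGroup \<Omega>\<^esub> y \<in> K" by (simp add: K_def)
  qed (auto simp: K_def)
  moreover have "orb2 \<Omega> K = orb2 \<Omega> H"
  proof -
    have "{(h a, h b) |h. h \<in> K} = {(h a, h b) |h. h \<in> H}" if "a \<in> \<Omega>" "b \<in> \<Omega>" for a b
    proof
      show "{(h a, h b) |h. h \<in> K} \<subseteq> {(h a, h b) |h. h \<in> H}"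
        using KD[OF _ that] by (smt (verit, best) mem_Collect_eq subsetI)
    next
      show "{(h a, h b) |h. h \<in> H} \<subseteq> {(h a, h b) |h. h \<in> K}"
        using subsetD[OF HK] by fast
    qed
    then show ?thesis
      unfolding orb2_eq_image by (intro image_cong refl) (simp only: case_prod_beta mem_Times_iff)
  qed
  ultimately have "K \<subseteq> two_closure \<Omega> H"
    by (rule two_closure_greatest(3)[OF H])
  moreover have "x \<in> K" if x: "x \<in> two_closure \<Omega> H"
  proof -
    note C = two_closure_greatest(1)[OF H]
    have "\<exists>h\<in>H. x a = h a \<and> x b = h b" if [simp]: "a \<in> \<Omega>" "b \<in> \<Omega>" for a b
    proof -
      have "{(h a, h b) |h. h \<in> two_closure \<Omega> H} \<in> orb2 \<Omega> (two_closure \<Omega> H)"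
        unfolding orb2_eq_image using that by (intro image_eqI[of _ _ "(a, b)"]) auto
      then have "{(h a, h b) |h. h \<in> two_closure \<Omega> H} \<in> orb2 \<Omega> H"
        by (simp only: two_closure_greatest(2)[OF H])
      \<comment> \<open>The orbit of \<open>(a, b)\<close> under the 2-closure is an
        \<open>H\<close>-orbit, but a priori with another base point \<open>(c, d)\<close>. The
        identity puts \<open>(a, b)\<close> into it, so \<open>h\<close> and \<open>k\<close> reach
        \<open>(a, b)\<close> and \<open>(x a, x b)\<close> from \<open>(c, d)\<close>, and
        \<open>k\<close> times the inverse of \<open>h\<close> is the required element.\<close>
      then obtain c d where [simp]: "c \<in> \<Omega>" "d \<in> \<Omega>"
        and eq: "{(h a, h b) |h. h \<in> two_closure \<Omega> H} = {(h c, h d) |h. h \<in> H}"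
        unfolding orb2_eq_image by auto
      have "(a, b) \<in> {(h a, h b) |h. h \<in> two_closure \<Omega> H}"
        using subgroup.one_closed[OF C] by (auto intro!: exI[of _ "\<one>\<^bsub>BijGroup \<Omega>\<^esub>"])
      then obtain h where h: "h \<in> H" "a = h c" "b = h d" unfolding eq by auto
      have "(x a, x b) \<in> {(h a, h b) |h. h \<in> two_closure \<Omega> H}" using x by auto
      then obtain k where k: "k \<in> H" "x a = k c" "x b = k d" unfolding eq by auto
      have "k \<otimes>\<^bsub>BijGroup \<Omega>\<^esub> inv\<^bsub>BijGroup \<Omega>\<^esub> h \<in> H"
        using h k H by (simp add: subgroup.m_closed subgroup.m_inv_closed)
      moreover have "(k \<otimes>\<^bsub>BijGroup \<Omega>\<^esub> inv\<^bsub>BijGroup \<Omega>\<^esub> h) a = k c" "(k \<otimes>\<^bsub>BijGroup \<Omega>\<^esub> inv\<^bsub>BijGroup \<Omega>\<^esub> h) b = k d"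
        using h k by simp_all
      ultimately show ?thesis using k by metis
    qed
    then show ?thesis using subgroup_BijGroup_mem[OF C x] by (simp add: K_def)
  qed
  ultimately show ?thesis unfolding K_def by blast
qed

lemma subset_two_closure: "subgroup H (BijGroup \<Omega>) \<Longrightarrow> H \<subseteq> two_closure \<Omega> H"
  by (simp add: two_closure_greatest(3))

lemma two_closedI:
  assumes "subgroup H (BijGroup \<Omega>)" "two_closure \<Omega> H \<subseteq> H"
  shows "two_closed \<Omega> H"
  using assms subset_two_closure unfolding two_closed_def by blast

lemma two_closure_mono:
  assumes "subgroup H (BijGroup \<Omega>)" "subgroup K (BijGroup \<Omega>)" "H \<subseteq> K"
  shows "two_closure \<Omega> H \<subseteq> two_closure \<Omega> K"
  using assms(3) by (fastforce simp: mem_two_closure_iff[OF assms(1)] mem_two_closure_iff[OF assms(2)])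

lemma two_closed_trivial: "two_closed \<Omega> {\<one>\<^bsub>BijGroup \<Omega>\<^esub>}"
proof -
  interpret B: group "BijGroup \<Omega>" by (rule group_BijGroup)
  have sub: "subgroup {\<one>\<^bsub>BijGroup \<Omega>\<^esub>} (BijGroup \<Omega>)" by (rule B.triv_subgroup)
  show ?thesis
  proof (rule two_closedI[OF sub], rule subsetI)
    fix x assume "x \<in> two_closure \<Omega> {\<one>\<^bsub>BijGroup \<Omega>\<^esub>}"
    then have "x = \<one>\<^bsub>BijGroup \<Omega>\<^esub>"
      by (intro Bij_eqI[of _ \<Omega>]) (auto simp: mem_two_closure_iff[OF sub])
    then show "x \<in> {\<one>\<^bsub>BijGroup \<Omega>\<^esub>}" by simp
  qed
qed

section \<open>Commuting permutation groups of coprime exponents\<close>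

text \<open>Since \<open>g\<close> and \<open>h\<close> commute, their agreement at \<open>a\<close>
  passes to all powers. An exponent that is 1 modulo \<open>m\<close> and 0 modulo \<open>n\<close>
  turns this into the claim.\<close>

lemma fixed_if_coprime_agree:
  assumes [simp]: "g \<in> Bij \<Omega>" "h \<in> Bij \<Omega>" "a \<in> \<Omega>"
    and comm: "g \<otimes>\<^bsub>BijGroup \<Omega>\<^esub> h = h \<otimes>\<^bsub>BijGroup \<Omega>\<^esub> g" and eq: "g a = h a"
    and pow: "g [^]\<^bsub>BijGroup \<Omega>\<^esub> (m::nat) = \<one>\<^bsub>BijGroup \<Omega>\<^esub>" "h [^]\<^bsub>BijGroup \<Omega>\<^esub> (n::nat) = \<one>\<^bsub>BijGroup \<Omega>\<^esub>"
    and mn: "coprime m n"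
  shows "g a = a"
proof -
  interpret B: group "BijGroup \<Omega>" by (rule group_BijGroup)
  have [simp]: "f [^]\<^bsub>BijGroup \<Omega>\<^esub> (k::nat) \<in> Bij \<Omega>" if "f \<in> Bij \<Omega>" for f k
    using B.nat_pow_closed that by simp
  have agree: "(g [^]\<^bsub>BijGroup \<Omega>\<^esub> k) a = (h [^]\<^bsub>BijGroup \<Omega>\<^esub> k) a" for k :: nat
  proof (induction k)
    case (Suc k)
    have "(g [^]\<^bsub>BijGroup \<Omega>\<^esub> Suc k) a = (g [^]\<^bsub>BijGroup \<Omega>\<^esub> k \<otimes>\<^bsub>BijGroup \<Omega>\<^esub> h) a"
      by (simp add: eq)
    also have "\<dots> = (h \<otimes>\<^bsub>BijGroup \<Omega>\<^esub> g [^]\<^bsub>BijGroup \<Omega>\<^esub> k) a"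
      using B.group_commutes_pow[OF comm] by simp
    also have "\<dots> = (h \<otimes>\<^bsub>BijGroup \<Omega>\<^esub> h [^]\<^bsub>BijGroup \<Omega>\<^esub> k) a"
      using Suc by simp
    finally show ?case
      using B.nat_pow_Suc2[of h k] by simp
  qed simp
  obtain e where e: "[e = 1] (mod m)" "[e = 0] (mod n)"
    using binary_chinese_remainder_nat[OF mn] by metis
  have "g [^]\<^bsub>BijGroup \<Omega>\<^esub> e = g [^]\<^bsub>BijGroup \<Omega>\<^esub> (1::nat)" "h [^]\<^bsub>BijGroup \<Omega>\<^esub> e = h [^]\<^bsub>BijGroup \<Omega>\<^esub> (0::nat)"
    by (rule B.pow_eq_pow_cong[OF _ pow(1) e(1)], simp) (rule B.pow_eq_pow_cong[OF _ pow(2) e(2)], simp)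
  then show ?thesis using agree[of e] by simp
qed

context
  fixes \<Omega> :: "'a set" and A B :: "('a \<Rightarrow> 'a) set" and m n :: nat
  assumes A: "subgroup A (BijGroup \<Omega>)" and B: "subgroup B (BijGroup \<Omega>)"
    and comm: "\<And>g h. g \<in> A \<Longrightarrow> h \<in> B \<Longrightarrow> g \<otimes>\<^bsub>BijGroup \<Omega>\<^esub> h = h \<otimes>\<^bsub>BijGroup \<Omega>\<^esub> g"
    and expA: "\<And>g. g \<in> A \<Longrightarrow> g [^]\<^bsub>BijGroup \<Omega>\<^esub> m = \<one>\<^bsub>BijGroup \<Omega>\<^esub>"
    and expB: "\<And>g. g \<in> B \<Longrightarrow> g [^]\<^bsub>BijGroup \<Omega>\<^esub> n = \<one>\<^bsub>BijGroup \<Omega>\<^esub>"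
    and coprime: "coprime m n"
begin

lemma component_apply_unique:
  assumes u: "u \<in> A" "u' \<in> A" and v: "v \<in> B" "v' \<in> B" and a[simp]: "a \<in> \<Omega>"
    and eq: "u (v a) = u' (v' a)"
  shows "u a = u' a"
proof -
  note [simp] = subgroup_BijGroup_mem[OF A] subgroup_BijGroup_mem[OF B]
  have comm': "g (h b) = h (g b)" if "g \<in> A" "h \<in> B" "b \<in> \<Omega>" for g h b
    using comm[OF that(1,2)] that by (metis BijGroup_mult_apply subgroup_BijGroup_mem A B)
  \<comment> \<open>Cancelling \<open>u'\<close> and \<open>v\<close> in \<open>eq\<close>, and
    moving \<open>v\<close> past \<open>?w\<close>, leaves \<open>?w a = ?c a\<close>, with one side
    in \<open>A\<close> and the other in \<open>B\<close>.\<close>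
  let ?w = "inv\<^bsub>BijGroup \<Omega>\<^esub> u' \<otimes>\<^bsub>BijGroup \<Omega>\<^esub> u" and ?c = "inv\<^bsub>BijGroup \<Omega>\<^esub> v \<otimes>\<^bsub>BijGroup \<Omega>\<^esub> v'"
  have w: "?w \<in> A" and c: "?c \<in> B"
    using u v A B by (simp_all add: subgroup.m_closed subgroup.m_inv_closed)
  have "v (?w a) = ?w (v a)" using comm'[OF w v(1) a] by simp
  also have "\<dots> = (inv\<^bsub>BijGroup \<Omega>\<^esub> u') (u' (v' a))" using u v eq by simp
  also have "\<dots> = v' a" using u v by simp
  finally have "v (?w a) = v' a" .
  then have "(inv\<^bsub>BijGroup \<Omega>\<^esub> v) (v (?w a)) = (inv\<^bsub>BijGroup \<Omega>\<^esub> v) (v' a)" by (rule arg_cong)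
  then have "?w a = ?c a" using u v by simp
  then have "?w a = a"
    using w c comm expA expB coprime by (intro fixed_if_coprime_agree[of ?w \<Omega> ?c a m n]) auto
  then have "u' (?w a) = u' a" by simp
  then show ?thesis using u by simp
qed

text \<open>The value \<open>u a\<close> is independent of the choice of \<open>u\<close> and
  \<open>v\<close>, which defines the \<open>A\<close>-component \<open>y\<close> of
  \<open>x\<close> point by point. The assumption \<open>closure\<close> is the pair criterion for
  the product of \<open>A\<close> and \<open>B\<close>; it is stated with separate factors so that
  the lemma also applies with the two groups exchanged.\<close>

lemma two_closure_component:
  assumes fin: "finite \<Omega>" and x: "x \<in> Bij \<Omega>"
    and closure: "\<And>a b. a \<in> \<Omega> \<Longrightarrow> b \<in> \<Omega> \<Longrightarrow> \<exists>u\<in>A. \<exists>v\<in>B. x a = u (v a) \<and> x b = u (v b)"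
  shows "\<exists>y\<in>two_closure \<Omega> A. \<forall>a\<in>\<Omega>. \<forall>u\<in>A. \<forall>v\<in>B. x a = u (v a) \<longrightarrow> y a = u a"
proof -
  note [simp] = subgroup_BijGroup_mem[OF A] subgroup_BijGroup_mem[OF B]
  define y where "y = restrict (\<lambda>a. (SOME u. u \<in> A \<and> (\<exists>v\<in>B. x a = u (v a))) a) \<Omega>"
  have y: "y a = u a" if "a \<in> \<Omega>" "u \<in> A" "v \<in> B" "x a = u (v a)" for a u v
  proof -
    let ?P = "\<lambda>u. u \<in> A \<and> (\<exists>v\<in>B. x a = u (v a))"
    have some: "?P (SOME u. ?P u)" using that by (intro someI[of ?P u]) blast
    then obtain v' where v': "v' \<in> B" "x a = (SOME u. ?P u) (v' a)" by blast
    have "(SOME u. ?P u) a = u a"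
      by (rule component_apply_unique[OF conjunct1[OF some] that(2) v'(1) that(3,1)])
        (rule trans[OF v'(2)[symmetric] that(4)])
    then show ?thesis using that by (simp add: y_def)
  qed
  \<comment> \<open>One choice of \<open>u\<close> and \<open>v\<close> serves both points. This
    gives injectivity of \<open>y\<close> as well as its membership in the 2-closure of
    \<open>A\<close>; finiteness of \<open>\<Omega>\<close> then makes \<open>y\<close>
    surjective.\<close>
  have agree: "\<exists>u\<in>A. y a = u a \<and> y b = u b" if ab: "a \<in> \<Omega>" "b \<in> \<Omega>" for a b
  proof -
    obtain u v where "u \<in> A" "v \<in> B" "x a = u (v a)" "x b = u (v b)" using closure[OF ab] by blast
    then show ?thesis using y ab by metis
  qed
  have "inj_on y \<Omega>"
  proof (rule inj_onI)
    fix a b assume ab: "a \<in> \<Omega>" "b \<in> \<Omega>" "y a = y b"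
    obtain u where "u \<in> A" "y a = u a" "y b = u b" using agree[OF ab(1,2)] by blast
    then show "a = b" using ab by (metis BijGroup_inv_apply(1) subgroup_BijGroup_mem[OF A])
  qed
  moreover have "y ` \<Omega> \<subseteq> \<Omega>"
    using agree by fastforce
  ultimately have "y \<in> Bij \<Omega>"
    using endo_inj_surj[OF fin] by (simp add: Bij_def bij_betw_def y_def)
  then have "y \<in> two_closure \<Omega> A"
    using agree by (simp add: mem_two_closure_iff[OF A])
  then show ?thesis using y by blast
qed

end

text \<open>The components \<open>y\<close> for \<open>A\<close> and \<open>z\<close> for
  \<open>B\<close> arise from the same construction with the groups exchanged, and their product is
  \<open>x\<close>.\<close>

lemma two_closure_coprime_product:
  assumes fin: "finite \<Omega>" and A: "subgroup A (BijGroup \<Omega>)" and B: "subgroup B (BijGroup \<Omega>)"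
    and AB: "subgroup (A <#>\<^bsub>BijGroup \<Omega>\<^esub> B) (BijGroup \<Omega>)"
    and comm: "\<And>g h. g \<in> A \<Longrightarrow> h \<in> B \<Longrightarrow> g \<otimes>\<^bsub>BijGroup \<Omega>\<^esub> h = h \<otimes>\<^bsub>BijGroup \<Omega>\<^esub> g"
    and expA: "\<And>g. g \<in> A \<Longrightarrow> g [^]\<^bsub>BijGroup \<Omega>\<^esub> (m::nat) = \<one>\<^bsub>BijGroup \<Omega>\<^esub>"
    and expB: "\<And>g. g \<in> B \<Longrightarrow> g [^]\<^bsub>BijGroup \<Omega>\<^esub> (n::nat) = \<one>\<^bsub>BijGroup \<Omega>\<^esub>"
    and mn: "coprime m n"
  shows "two_closure \<Omega> (A <#>\<^bsub>BijGroup \<Omega>\<^esub> B)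
    \<subseteq> two_closure \<Omega> A <#>\<^bsub>BijGroup \<Omega>\<^esub> two_closure \<Omega> B"
proof
  fix x assume mem: "x \<in> two_closure \<Omega> (A <#>\<^bsub>BijGroup \<Omega>\<^esub> B)"
  then have x: "x \<in> Bij \<Omega>" by (simp add: mem_two_closure_iff[OF AB])
  have closure: "\<exists>g\<in>A <#>\<^bsub>BijGroup \<Omega>\<^esub> B. x a = g a \<and> x b = g b" if "a \<in> \<Omega>" "b \<in> \<Omega>" for a b
    using mem that by (simp add: mem_two_closure_iff[OF AB])
  note [simp] = subgroup_BijGroup_mem[OF A] subgroup_BijGroup_mem[OF B]
  have comm': "g (h b) = h (g b)" if "g \<in> A" "h \<in> B" "b \<in> \<Omega>" for g h b
    using comm[OF that(1,2)] that by (metis BijGroup_mult_apply subgroup_BijGroup_mem A B)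
  have comm_sym: "h \<otimes>\<^bsub>BijGroup \<Omega>\<^esub> g = g \<otimes>\<^bsub>BijGroup \<Omega>\<^esub> h" if "h \<in> B" "g \<in> A" for g h
    using comm[OF that(2,1)] by (rule sym)
  have cl: "\<exists>u\<in>A. \<exists>v\<in>B. x a = u (v a) \<and> x b = u (v b)" if "a \<in> \<Omega>" "b \<in> \<Omega>" for a b
    using closure[OF that] that unfolding set_mult_def by force
  have "\<exists>y\<in>two_closure \<Omega> A. \<forall>a\<in>\<Omega>. \<forall>u\<in>A. \<forall>v\<in>B. x a = u (v a) \<longrightarrow> y a = u a"
    by (rule two_closure_component) (fact A B comm expA expB mn fin x cl)+
  then obtain y where y: "y \<in> two_closure \<Omega> A"
    "\<And>a u v. a \<in> \<Omega> \<Longrightarrow> u \<in> A \<Longrightarrow> v \<in> B \<Longrightarrow> x a = u (v a) \<Longrightarrow> y a = u a"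
    by blast
  have cl': "\<exists>v\<in>B. \<exists>u\<in>A. x a = v (u a) \<and> x b = v (u b)" if "a \<in> \<Omega>" "b \<in> \<Omega>" for a b
    using cl[OF that] comm' that by metis
  have "\<exists>z\<in>two_closure \<Omega> B. \<forall>a\<in>\<Omega>. \<forall>v\<in>B. \<forall>u\<in>A. x a = v (u a) \<longrightarrow> z a = v a"
    by (rule two_closure_component)
      (fact A B comm_sym expA expB mn[unfolded coprime_commute[of m]] fin x cl')+
  then obtain z where z: "z \<in> two_closure \<Omega> B"
    "\<And>a u v. a \<in> \<Omega> \<Longrightarrow> v \<in> B \<Longrightarrow> u \<in> A \<Longrightarrow> x a = v (u a) \<Longrightarrow> z a = v a"
    by blast
  have yB: "y \<in> Bij \<Omega>" and zB: "z \<in> Bij \<Omega>"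
    using y z by (simp_all add: mem_two_closure_iff A B)
  have "x = y \<otimes>\<^bsub>BijGroup \<Omega>\<^esub> z"
  proof (rule Bij_eqI)
    fix a assume a[simp]: "a \<in> \<Omega>"
    obtain u v where uv: "u \<in> A" "v \<in> B" "x a = u (v a)"
      using cl[OF a a] by blast
    then have xa: "x a = v (u a)" using comm'[OF uv(1,2) a] by simp
    have za: "z a = v a" by (rule z(2)[OF a uv(2,1) xa])
    have va: "v a \<in> \<Omega>" using uv by simp
    \<comment> \<open>Here \<open>y\<close> must be evaluated at \<open>z a = v a\<close>, where the
      pair \<open>u\<close>, \<open>v\<close> chosen at \<open>a\<close> may fail. A pair valid at
      both \<open>a\<close> and \<open>v a\<close> gives \<open>y (v a) = v (u' a)\<close>, and
      \<open>u' a = u a\<close> because both are \<open>y a\<close>.\<close>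
    obtain u' v' where u'v': "u' \<in> A" "v' \<in> B" "x a = u' (v' a)" "x (v a) = u' (v' (v a))"
      using cl[OF a va] by blast
    have "y (v a) = u' (v a)" using y(2)[OF va] u'v' by blast
    also have "\<dots> = v (u' a)" by (rule comm'[OF u'v'(1) uv(2) a])
    also have "u' a = u a"
      using y(2)[OF a u'v'(1,2,3)] y(2)[OF a uv] by simp
    also have "v (u a) = x a" by (rule xa[symmetric])
    finally show "x a = (y \<otimes>\<^bsub>BijGroup \<Omega>\<^esub> z) a"
      using za yB zB by simp
  qed (use x yB zB in simp_all)
  then show "x \<in> two_closure \<Omega> A <#>\<^bsub>BijGroup \<Omega>\<^esub> two_closure \<Omega> B"
    using y(1) z(1) unfolding set_mult_def by blast
qed

section \<open>Sylow subgroups and 2-closedness of a nilpotent permutation group\<close>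

context
  fixes \<Omega> :: "'a set" and G :: "('a \<Rightarrow> 'a) set"
  assumes fin: "finite \<Omega>" and G: "subgroup G (BijGroup \<Omega>)"
    and nil: "nilpotent_group (perm_group \<Omega> G)"
begin

lemma finite_perm_group: "finite (carrier (perm_group \<Omega> G))"
  using finite_subset[OF subgroup.subset[OF G]] finite_Bij[OF fin] by simp

lemma perm_group_pow: "x [^]\<^bsub>perm_group \<Omega> G\<^esub> (k::nat) = x [^]\<^bsub>BijGroup \<Omega>\<^esub> k"
  using monoid.nat_pow_consistent[OF group.is_monoid[OF group_BijGroup]] by metis

lemma perm_group_coprime_commute:
  assumes "x \<in> G" "y \<in> G" "x [^]\<^bsub>BijGroup \<Omega>\<^esub> (m::nat) = \<one>\<^bsub>BijGroup \<Omega>\<^esub>"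
    "y [^]\<^bsub>BijGroup \<Omega>\<^esub> (n::nat) = \<one>\<^bsub>BijGroup \<Omega>\<^esub>" "coprime m n"
  shows "x \<otimes>\<^bsub>BijGroup \<Omega>\<^esub> y = y \<otimes>\<^bsub>BijGroup \<Omega>\<^esub> x"
  using coprime_pow_commute[OF nil, of x y m n] assms by (simp add: perm_group_pow)

lemma two_closed_sylow:
  assumes closed: "two_closed \<Omega> G" and P: "subgroup P (perm_group \<Omega> G)" "prime p"
    "card P = p ^ multiplicity p (order (perm_group \<Omega> G))"
  shows "two_closed \<Omega> P"
proof -
  interpret B: group "BijGroup \<Omega>" by (rule group_BijGroup)
  interpret GG: group "perm_group \<Omega> G" by (rule B.subgroup_imp_group[OF G])
  let ?N = "order (perm_group \<Omega> G)"
  let ?q = "p ^ multiplicity p ?N"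
  have PB: "subgroup P (BijGroup \<Omega>)" by (rule B.incl_subgroup[OF G P(1)])
  note PG = subgroup.subset[OF P(1), simplified]
  have mem_P: "x \<in> P \<longleftrightarrow> x \<in> G \<and> x [^]\<^bsub>BijGroup \<Omega>\<^esub> ?q = \<one>\<^bsub>BijGroup \<Omega>\<^esub>" for x
    using sylow_eq_torsion[OF nil finite_perm_group P] by (auto simp: perm_group_pow)
  have "?N \<noteq> 0" using finite_perm_group GG.order_gt_0_iff_finite by simp
  then obtain k where N: "?N = ?q * k" and "\<not> p dvd k"
    using multiplicity_decompose'[of ?N p] P(2) by (metis not_prime_unit)
  then have k: "coprime ?q k"
    using P(2) by (simp add: prime_imp_coprime)
  show ?thesis
  proof (rule two_closedI[OF PB], rule subsetI)
    fix x assume x: "x \<in> two_closure \<Omega> P"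
    then have "x \<in> G"
      using two_closure_mono[OF PB G PG] closed by (auto simp: two_closed_def)
    then have xG: "x \<in> carrier (perm_group \<Omega> G)" by simp
    have "x [^]\<^bsub>perm_group \<Omega> G\<^esub> (?q * k) = \<one>\<^bsub>perm_group \<Omega> G\<^esub>"
      using GG.pow_order_eq_1[OF xG] N by metis
    \<comment> \<open>These are the \<open>p\<close>-part and the \<open>p'\<close>-part of
      \<open>x\<close>. The first lies in \<open>P\<close> by the torsion description, so it remains
      to show that \<open>z\<close> is trivial.\<close>
    then obtain y z where yz: "y \<in> G" "z \<in> G" "x = y \<otimes>\<^bsub>BijGroup \<Omega>\<^esub> z"
        "y [^]\<^bsub>BijGroup \<Omega>\<^esub> ?q = \<one>\<^bsub>BijGroup \<Omega>\<^esub>" "z [^]\<^bsub>BijGroup \<Omega>\<^esub> k = \<one>\<^bsub>BijGroup \<Omega>\<^esub>"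
      using GG.pow_coprime_decomp[OF xG _ k] by (auto simp: perm_group_pow)
    have [simp]: "y \<in> Bij \<Omega>" "z \<in> Bij \<Omega>" using yz(1,2) subgroup_BijGroup_mem[OF G] by auto
    have y: "y \<in> P" using mem_P yz by simp
    have "z a = a" if a[simp]: "a \<in> \<Omega>" for a
    proof -
      obtain h where h: "h \<in> P" "x a = h a"
        using x a unfolding mem_two_closure_iff[OF PB] by blast
      have [simp]: "h \<in> Bij \<Omega>" using h(1) subgroup_BijGroup_mem[OF PB] by auto
      \<comment> \<open>The element \<open>h\<close> depends on \<open>a\<close>, but
        \<open>?g\<close> always lies in \<open>P\<close> and agrees with \<open>z\<close> at
        \<open>a\<close>; the orders of \<open>?g\<close> and \<open>z\<close> are coprime.\<close>
      let ?g = "inv\<^bsub>BijGroup \<Omega>\<^esub> y \<otimes>\<^bsub>BijGroup \<Omega>\<^esub> h"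
      have g: "?g \<in> P" using y h(1) PB by (simp add: subgroup.m_closed subgroup.m_inv_closed)
      have "?g a = (inv\<^bsub>BijGroup \<Omega>\<^esub> y) (y (z a))"
        using h(2) yz(3) by simp
      then have ga: "?g a = z a" by simp
      have gq: "?g \<in> G" "?g [^]\<^bsub>BijGroup \<Omega>\<^esub> ?q = \<one>\<^bsub>BijGroup \<Omega>\<^esub>"
        using g unfolding mem_P by blast+
      have "?g a = a"
        by (rule fixed_if_coprime_agree[OF _ _ a
              perm_group_coprime_commute[OF gq(1) yz(2) gq(2) yz(5) k] ga gq(2) yz(5) k]) simp_all
      then show ?thesis using ga by simp
    qed
    then have "z = \<one>\<^bsub>BijGroup \<Omega>\<^esub>"
      by (intro Bij_eqI[of _ \<Omega>]) auto
    then show "x \<in> P" using yz(3) y by simp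
  qed
qed

text \<open>For the product of the full prime powers over \<open>S\<close>, the torsion set
  \<open>K\<close> is the Hall subgroup belonging to \<open>S\<close>. That it is a subgroup is
  proved within the same induction: adding a prime multiplies the previous Hall subgroup by a normal
  Sylow subgroup.\<close>

lemma two_closed_hall:
  assumes sylow: "\<And>P. sylow_subgroup (perm_group \<Omega> G) P \<Longrightarrow> two_closed \<Omega> P"
    and S: "finite S" "\<And>q. q \<in> S \<Longrightarrow> prime q"
  defines "N \<equiv> order (perm_group \<Omega> G)"
  defines "K \<equiv> \<lambda>n::nat. {x \<in> G. x [^]\<^bsub>BijGroup \<Omega>\<^esub> n = \<one>\<^bsub>BijGroup \<Omega>\<^esub>}"
  shows "subgroup (K (\<Prod>q\<in>S. q ^ multiplicity q N)) (perm_group \<Omega> G)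
    \<and> two_closed \<Omega> (K (\<Prod>q\<in>S. q ^ multiplicity q N))"
  using S
proof (induction S rule: finite_induct)
  interpret B: group "BijGroup \<Omega>" by (rule group_BijGroup)
  interpret GG: group "perm_group \<Omega> G" by (rule B.subgroup_imp_group[OF G])
  case empty
  have "K 1 = {\<one>\<^bsub>BijGroup \<Omega>\<^esub>}"
    using subgroup_BijGroup_mem[OF G] subgroup.one_closed[OF G] by (auto simp: K_def)
  then show ?case using two_closed_trivial GG.triv_subgroup by simp
next
  interpret B: group "BijGroup \<Omega>" by (rule group_BijGroup)
  interpret GG: group "perm_group \<Omega> G" by (rule B.subgroup_imp_group[OF G])
  case (insert p S)
  let ?n = "\<Prod>q\<in>S. q ^ multiplicity q N" and ?q = "p ^ multiplicity p N"
  let ?A = "K ?n" and ?P = "K ?q"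
  have A: "subgroup ?A (perm_group \<Omega> G)" "two_closed \<Omega> ?A" using insert by auto
  have p: "prime p" using insert by simp
  obtain P where P: "subgroup P (perm_group \<Omega> G)" "card P = ?q"
    using GG.sylow_exists[OF finite_perm_group p] unfolding N_def by metis
  note P' = P(1) p P(2)[unfolded N_def]
  have PK: "P = ?P"
    using sylow_eq_torsion[OF nil finite_perm_group P'] by (auto simp: K_def N_def perm_group_pow)
  have Pcl: "two_closed \<Omega> P"
    by (rule sylow) (use P' in \<open>auto simp: sylow_subgroup_def\<close>)
  have cop: "coprime ?n ?q"
    using insert by (intro prod_coprime_left coprime_power_left_iff[THEN iffD2]) (auto intro!: primes_coprime)
  \<comment> \<open>Normality of \<open>P\<close> makes the product a subgroup; commutation of the
    factors then allows the order \<open>?A\<close>, \<open>P\<close> used below.\<close>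
  have "subgroup (P <#>\<^bsub>perm_group \<Omega> G\<^esub> ?A) (perm_group \<Omega> G)"
    by (rule GG.mult_norm_subgroup[OF sylow_normal[OF nil finite_perm_group P'] A(1)])
  moreover have comm: "g \<otimes>\<^bsub>BijGroup \<Omega>\<^esub> h = h \<otimes>\<^bsub>BijGroup \<Omega>\<^esub> g" if "g \<in> ?A" "h \<in> P" for g h
    using that cop by (intro perm_group_coprime_commute) (auto simp: PK K_def)
  then have "P <#>\<^bsub>BijGroup \<Omega>\<^esub> ?A = ?A <#>\<^bsub>BijGroup \<Omega>\<^esub> P"
    unfolding set_mult_def by force
  ultimately have AP: "subgroup (?A <#>\<^bsub>BijGroup \<Omega>\<^esub> P) (perm_group \<Omega> G)"
    by (simp add: set_mult_def)
  have "two_closure \<Omega> (?A <#>\<^bsub>BijGroup \<Omega>\<^esub> P) \<subseteq> two_closure \<Omega> ?A <#>\<^bsub>BijGroup \<Omega>\<^esub> two_closure \<Omega> P"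
    by (rule two_closure_coprime_product[OF fin B.incl_subgroup[OF G A(1)] B.incl_subgroup[OF G P(1)]
          B.incl_subgroup[OF G AP] comm _ _ cop]) (auto simp: PK K_def)
  then have "two_closed \<Omega> (?A <#>\<^bsub>BijGroup \<Omega>\<^esub> P)"
    using A(2) Pcl by (intro two_closedI B.incl_subgroup[OF G AP]) (simp add: two_closed_def)
  moreover have "?A <#>\<^bsub>BijGroup \<Omega>\<^esub> P = K (?n * ?q)"
  proof
    show "?A <#>\<^bsub>BijGroup \<Omega>\<^esub> P \<subseteq> K (?n * ?q)"
    proof
      fix x assume "x \<in> ?A <#>\<^bsub>BijGroup \<Omega>\<^esub> P"
      then obtain y z where yz: "y \<in> ?A" "z \<in> P" "x = y \<otimes>\<^bsub>BijGroup \<Omega>\<^esub> z"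
        unfolding set_mult_def by blast
      have [simp]: "y \<in> Bij \<Omega>" "z \<in> Bij \<Omega>"
        using yz subgroup_BijGroup_mem[OF G] by (auto simp: PK K_def)
      have "x [^]\<^bsub>BijGroup \<Omega>\<^esub> (?n * ?q)
          = (y [^]\<^bsub>BijGroup \<Omega>\<^esub> ?n) [^]\<^bsub>BijGroup \<Omega>\<^esub> ?q \<otimes>\<^bsub>BijGroup \<Omega>\<^esub> (z [^]\<^bsub>BijGroup \<Omega>\<^esub> ?q) [^]\<^bsub>BijGroup \<Omega>\<^esub> ?n"
        unfolding yz(3) using comm[OF yz(1,2)]
        by (subst B.pow_mult_distrib) (simp_all add: B.nat_pow_pow mult.commute)
      then have "x [^]\<^bsub>BijGroup \<Omega>\<^esub> (?n * ?q) = \<one>\<^bsub>BijGroup \<Omega>\<^esub>"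
        using yz by (simp add: PK K_def)
      then show "x \<in> K (?n * ?q)"
        using yz subgroup.m_closed[OF G] by (auto simp: PK K_def)
    qed
    \<comment> \<open>Splitting an element into parts killed by \<open>?n\<close> and by
      \<open>?q\<close> produces the two factors.\<close>
    show "K (?n * ?q) \<subseteq> ?A <#>\<^bsub>BijGroup \<Omega>\<^esub> P"
    proof
      fix x assume "x \<in> K (?n * ?q)"
      then have "x \<in> carrier (perm_group \<Omega> G)" "x [^]\<^bsub>perm_group \<Omega> G\<^esub> (?n * ?q) = \<one>\<^bsub>perm_group \<Omega> G\<^esub>"
        by (simp_all add: K_def perm_group_pow)
      then obtain y z where "y \<in> G" "z \<in> G" "x = y \<otimes>\<^bsub>BijGroup \<Omega>\<^esub> z"
        "y [^]\<^bsub>BijGroup \<Omega>\<^esub> ?n = \<one>\<^bsub>BijGroup \<Omega>\<^esub>" "z [^]\<^bsub>BijGroup \<Omega>\<^esub> ?q = \<one>\<^bsub>BijGroup \<Omega>\<^esub>"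
        using GG.pow_coprime_decomp[OF _ _ cop] by (auto simp: perm_group_pow)
      then show "x \<in> ?A <#>\<^bsub>BijGroup \<Omega>\<^esub> P"
        unfolding set_mult_def by (auto simp: PK K_def)
    qed
  qed
  moreover have "(\<Prod>q\<in>insert p S. q ^ multiplicity q N) = ?n * ?q"
    using insert by (simp add: mult.commute)
  ultimately show ?case using AP by simp
qed

lemma two_closed_if_sylow:
  assumes "\<And>P. sylow_subgroup (perm_group \<Omega> G) P \<Longrightarrow> two_closed \<Omega> P"
  shows "two_closed \<Omega> G"
proof -
  interpret B: group "BijGroup \<Omega>" by (rule group_BijGroup)
  interpret GG: group "perm_group \<Omega> G" by (rule B.subgroup_imp_group[OF G])
  let ?N = "order (perm_group \<Omega> G)"
  have "?N \<noteq> 0" using finite_perm_group GG.order_gt_0_iff_finite by simp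
  \<comment> \<open>With \<open>S\<close> the set of all primes dividing the order, the exponent is
    the order of \<open>G\<close>, and the torsion set is \<open>G\<close> itself.\<close>
  then have "(\<Prod>q\<in>prime_factors ?N. q ^ multiplicity q ?N) = ?N"
    using prod_prime_factors[of ?N] by simp
  moreover have "{x \<in> G. x [^]\<^bsub>BijGroup \<Omega>\<^esub> ?N = \<one>\<^bsub>BijGroup \<Omega>\<^esub>} = G"
    using GG.pow_order_eq_1 by (auto simp: perm_group_pow)
  ultimately show ?thesis
    using two_closed_hall[OF assms, of "prime_factors ?N"] by auto
qed

end

theorem corollary1p2:
  fixes \<Omega> :: "'a set" and G :: "('a \<Rightarrow> 'a) set"
  assumes "finite \<Omega>"
    and "subgroup G (BijGroup \<Omega>)"
    and "nilpotent_group (perm_group \<Omega> G)"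
  shows "two_closed \<Omega> G \<longleftrightarrow>
    (\<forall>P. sylow_subgroup (perm_group \<Omega> G) P \<longrightarrow> two_closed \<Omega> P)"
  using two_closed_sylow[OF assms] two_closed_if_sylow[OF assms]
  unfolding sylow_subgroup_def by blast

end
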